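(* Let $C,D$ be two closed convex sets in a real Hilbert space $H$ with $C\cap D\ne\emptyset$, and let $T_{C,D}=\frac12(I+R_DR_C)$ be the Douglas--Rachford operator. Let $\{(y^t,z^t,x^t)\}$ be generated, from an arbitrary $x^0\in H$, by the Douglas--Rachford algorithm $$y^{t+1}:=P_C(x^t),\qquad z^{t+1}:=P_D(2y^{t+1}-x^t),\qquad x^{t+1}:=x^t+(z^{t+1}-y^{t+1}),\qquad t\in\mathbb{N}.$$ Suppose that $T_{C,D}$ is bounded Hölder regular. Then $x^t\to\bar x$ in norm for some $\bar x\in\operatorname{Fix}T_{C,D}$ with at least a sublinear rate $O(t^{-\rho})$ for some $\rho>0$. In particular, if $T_{C,D}$ is bounded Hölder regular with uniform exponent $\gamma\in(0,1]$, then there exist $M>0$ and $r\in(0,1)$ such that, for all $t\ge1$, $$\|x^t-\bar x\|\le\begin{cases}M\,t^{-\frac{\gamma}{2(1-\gamma)}}&\text{if }\gamma\in(0,1),\\ M\,r^t&\text{if }\gamma=1.\end{cases}$$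
   Context: $\mathbb{N}=\{0,1,2,\dots\}$; $\operatorname{Fix}T=\{x\in H: T(x)=x\}$; $d(x,A)=\inf_{a\in A}\|x-a\|$; $P_A$ is the nearest point projection onto the closed convex set $A$, $R_A:=2P_A-I$, and $I$ is the identity. The iteration is equivalent to $x^{t+1}=T_{C,D}(x^t)$. An operator $T:H\to H$ is bounded Hölder regular if for each bounded set $K\subseteq H$ there exist $\gamma\in(0,1]$ and $\mu>0$ such that $d(x,\operatorname{Fix}T)\le\mu\|x-T(x)\|^\gamma$ for all $x\in K$. If the exponent $\gamma$ can be chosen independently of $K$, $T$ is bounded Hölder regular with uniform exponent $\gamma$. Convergence with rate $O(t^{-\rho})$ means $\|x^t-\bar x\|\le Mt^{-\rho}$ for all $t\ge1$ and some constant $M$. *)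

theory Defs
  imports "HOL-Analysis.Analysis"
begin

text \<open>
  A real Hilbert space, of any dimension, is a type of class \<open>{real_inner, complete_space}\<close>.
  The library's \<open>closest_point\<close> requires \<open>heine_borel\<close>, hence finite dimension; \<open>nearest_point\<close>
  is its definition without that restriction. It is the projection onto \<open>A\<close> when \<open>A\<close> is
  nonempty, closed and convex, where the nearest point exists and is unique.
\<close>

definition nearest_point :: "'a::real_inner set \<Rightarrow> 'a \<Rightarrow> 'a"
  where "nearest_point A x = (SOME p. p \<in> A \<and> (\<forall>a\<in>A. dist x p \<le> dist x a))"

definition reflector :: "'a::real_inner set \<Rightarrow> 'a \<Rightarrow> 'a"
  where "reflector A x = 2 *\<^sub>R nearest_point A x - x"

definition DR_operator :: "'a::real_inner set \<Rightarrow> 'a set \<Rightarrow> 'a \<Rightarrow> 'a"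
  where "DR_operator C D x = (1/2) *\<^sub>R (x + reflector D (reflector C x))"

definition Fix :: "('a \<Rightarrow> 'a) \<Rightarrow> 'a set"
  where "Fix T = {x. T x = x}"

text \<open>
  Below, \<open>infdist x (Fix T)\<close> is the distance \<open>d(x, Fix T)\<close>. The library sets \<open>infdist x {} = 0\<close>,
  so these definitions are meant for operators with a fixed point; every point of
  \<open>C \<inter> D\<close> is a fixed point of \<open>DR_operator C D\<close>.
\<close>

definition holder_regular_on :: "'a::real_inner set \<Rightarrow> real \<Rightarrow> ('a \<Rightarrow> 'a) \<Rightarrow> bool"
  where "holder_regular_on K \<gamma> T \<longleftrightarrow>
    (\<exists>\<mu>>0. \<forall>x\<in>K. infdist x (Fix T) \<le> \<mu> * norm (x - T x) powr \<gamma>)"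

definition bounded_holder_regular :: "('a::real_inner \<Rightarrow> 'a) \<Rightarrow> bool"
  where "bounded_holder_regular T \<longleftrightarrow>
    (\<forall>K. bounded K \<longrightarrow> (\<exists>\<gamma>\<in>{0<..1}. holder_regular_on K \<gamma> T))"

definition bounded_holder_regular_uniform :: "real \<Rightarrow> ('a::real_inner \<Rightarrow> 'a) \<Rightarrow> bool"
  where "bounded_holder_regular_uniform \<gamma> T \<longleftrightarrow>
    \<gamma> \<in> {0<..1} \<and> (\<forall>K. bounded K \<longrightarrow> holder_regular_on K \<gamma> T)"

end

theory Submission
  imports Defs
begin

text \<open>
  The operator \<open>T = DR_operator C D\<close> is the average of the identity and a nonexpansive map, so
  \<open>\<parallel>Tu - Tv\<parallel>\<^sup>2 + \<parallel>(u - Tu) - (v - Tv)\<parallel>\<^sup>2 \<le> \<parallel>u - v\<parallel>\<^sup>2\<close>. Taking \<open>v\<close> in \<open>Fix T\<close> and the infimum over \<open>v\<close>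
  gives \<open>d\<^sub>t\<^sub>+\<^sub>1\<^sup>2 + \<parallel>x\<^sub>t - x\<^sub>t\<^sub>+\<^sub>1\<parallel>\<^sup>2 \<le> d\<^sub>t\<^sup>2\<close> for the distances \<open>d\<^sub>t\<close> of the iterates to \<open>Fix T\<close>. Hoelder
  regularity on the bounded orbit bounds the middle term below by a multiple of \<open>d\<^sub>t\<close> to the
  power \<open>2 / \<gamma>\<close>, and this recursion yields the rate for \<open>d\<^sub>t\<close>. By Fejer monotonicity the distance
  of \<open>x\<^sub>t\<close> to the limit is at most \<open>2 d\<^sub>t\<close>.
\<close>

subsection \<open>Nearest points in a Hilbert space\<close>

lemma infdist_greatest:
  assumes "A \<noteq> {}" "\<And>a. a \<in> A \<Longrightarrow> c \<le> dist x a"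
  shows "c \<le> infdist x A"
  using assms by (auto simp: infdist_def intro: cINF_greatest)

text \<open>Parallelogram law at the midpoint of \<open>a\<close> and \<open>b\<close>: by convexity
  the midpoint lies in \<open>A\<close>, so it is no closer to \<open>u\<close> than
  \<open>infdist u A\<close>. Almost nearest points are therefore close to each other.\<close>

lemma dist_le_of_almost_nearest:
  fixes A :: "'a::real_inner set"
  assumes "convex A" "a \<in> A" "b \<in> A"
  shows "(dist a b)\<^sup>2 \<le> 2 * (dist u a)\<^sup>2 + 2 * (dist u b)\<^sup>2 - 4 * (infdist u A)\<^sup>2"
proof -
  define m where "m = (1/2) *\<^sub>R a + (1/2) *\<^sub>R b"
  have "m \<in> A"
    unfolding m_def using assms by (intro convexD) auto
  then have "infdist u A \<le> dist u m"
    by (rule infdist_le)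
  then have "(infdist u A)\<^sup>2 \<le> (dist u m)\<^sup>2"
    by (intro power_mono infdist_nonneg)
  moreover have "(dist a b)\<^sup>2 + 4 * (dist u m)\<^sup>2 = 2 * (dist u a)\<^sup>2 + 2 * (dist u b)\<^sup>2"
    by (simp add: m_def dist_norm power2_norm_eq_inner inner_diff inner_add inner_commute
        algebra_simps)
  ultimately show ?thesis
    by linarith
qed

text \<open>Cantor intersection: the sets \<open>S n\<close> of almost nearest points are closed,
  nonempty and nested, with diameters tending to 0. Completeness takes the place of
  compactness.\<close>

lemma nearest_point_exists:
  fixes A :: "'a::{real_inner, complete_space} set"
  assumes "closed A" "convex A" "A \<noteq> {}"
  shows "\<exists>p\<in>A. \<forall>a\<in>A. dist u p \<le> dist u a"
proof -
  define \<delta> where "\<delta> = infdist u A"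
  define S where "S n = {a \<in> A. (dist u a)\<^sup>2 \<le> \<delta>\<^sup>2 + 1 / real (Suc n)}" for n
  have \<delta>: "0 \<le> \<delta>"
    by (simp add: \<delta>_def infdist_nonneg)
  have "closed (S n)" for n
  proof -
    have "S n = A \<inter> {a. (dist u a)\<^sup>2 \<le> \<delta>\<^sup>2 + 1 / real (Suc n)}"
      by (auto simp: S_def)
    then show ?thesis
      using assms(1) by (auto intro!: closed_Int closed_Collect_le continuous_intros)
  qed
  moreover have "S n \<noteq> {}" for n
  proof
    assume "S n = {}"
    then have "sqrt (\<delta>\<^sup>2 + 1 / real (Suc n)) \<le> dist u a" if "a \<in> A" for a
      using that by (intro real_le_lsqrt) (auto simp: S_def not_le less_imp_le)
    then have "sqrt (\<delta>\<^sup>2 + 1 / real (Suc n)) \<le> \<delta>"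
      unfolding \<delta>_def by (intro infdist_greatest assms(3))
    moreover have "\<delta> < sqrt (\<delta>\<^sup>2 + 1 / real (Suc n))"
      by (rule real_less_rsqrt) simp
    ultimately show False
      by simp
  qed
  moreover have "S n \<subseteq> S m" if "m \<le> n" for m n
  proof -
    have "1 / real (Suc n) \<le> 1 / real (Suc m)"
      using that by (simp add: frac_le)
    then show ?thesis
      by (auto simp: S_def)
  qed
  moreover have "\<exists>n. \<forall>a\<in>S n. \<forall>b\<in>S n. dist a b < e" if "e > 0" for e
  proof -
    \<comment> \<open>On \<open>S n\<close> the parallelogram bound is at most
      \<open>4 / real (Suc n)\<close>, hence the threshold \<open>e\<^sup>2 / 4\<close>.\<close>
    obtain n where n: "1 / real (Suc n) < e\<^sup>2 / 4"
      using nat_approx_posE[of "e\<^sup>2 / 4"] \<open>e > 0\<close> by auto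
    have "dist a b < e" if "a \<in> S n" "b \<in> S n" for a b
    proof -
      have "(dist a b)\<^sup>2 \<le> 2 * (dist u a)\<^sup>2 + 2 * (dist u b)\<^sup>2 - 4 * \<delta>\<^sup>2"
        using that assms unfolding \<delta>_def S_def by (intro dist_le_of_almost_nearest) auto
      moreover have "(dist u a)\<^sup>2 \<le> \<delta>\<^sup>2 + 1 / real (Suc n)" "(dist u b)\<^sup>2 \<le> \<delta>\<^sup>2 + 1 / real (Suc n)"
        using that by (auto simp: S_def)
      ultimately have "(dist a b)\<^sup>2 < e\<^sup>2"
        using n by linarith
      then show ?thesis
        using \<open>e > 0\<close> by (intro power2_less_imp_less[of "dist a b" e]) auto
    qed
    then show ?thesis
      by blast
  qed
  ultimately obtain p where p: "\<And>n. p \<in> S n"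
    using decreasing_closed_nest[of S] by blast
  have "(\<lambda>n. \<delta>\<^sup>2 + 1 / real (Suc n)) \<longlonglongrightarrow> \<delta>\<^sup>2 + 0"
    by (intro tendsto_intros LIMSEQ_Suc[OF lim_1_over_n])
  then have "(dist u p)\<^sup>2 \<le> \<delta>\<^sup>2"
    using p by (intro LIMSEQ_le_const) (auto simp: S_def)
  then have "dist u p \<le> \<delta>"
    using \<delta> by (rule power2_le_imp_le)
  moreover have "p \<in> A"
    using p by (auto simp: S_def)
  ultimately show ?thesis
    unfolding \<delta>_def by (meson infdist_le order_trans)
qed

lemma nearest_point:
  fixes A :: "'a::{real_inner, complete_space} set"
  assumes "closed A" "convex A" "A \<noteq> {}"
  shows "nearest_point A u \<in> A"
    and "a \<in> A \<Longrightarrow> dist u (nearest_point A u) \<le> dist u a"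
proof -
  have "nearest_point A u \<in> A \<and> (\<forall>a\<in>A. dist u (nearest_point A u) \<le> dist u a)"
    unfolding nearest_point_def
    by (rule someI_ex) (use nearest_point_exists[OF assms, of u] in blast)
  then show "nearest_point A u \<in> A" "a \<in> A \<Longrightarrow> dist u (nearest_point A u) \<le> dist u a"
    by auto
qed

lemma nearest_point_self:
  fixes A :: "'a::{real_inner, complete_space} set"
  assumes "closed A" "convex A" "u \<in> A"
  shows "nearest_point A u = u"
proof -
  have "dist u (nearest_point A u) \<le> dist u u"
    using assms by (intro nearest_point(2)) auto
  then show ?thesis
    by simp
qed

text \<open>Sum of two obtuse-angle inequalities, one at each projection, each tested against the
  other projection.\<close>

lemma nearest_point_firmly_nonexpansive:
  fixes A :: "'a::{real_inner, complete_space} set"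
  assumes "closed A" "convex A" "A \<noteq> {}"
  shows "(norm (nearest_point A u - nearest_point A v))\<^sup>2
           \<le> inner (u - v) (nearest_point A u - nearest_point A v)"
proof -
  have "inner (u - nearest_point A u) (nearest_point A v - nearest_point A u) \<le> 0"
       "inner (v - nearest_point A v) (nearest_point A u - nearest_point A v) \<le> 0"
    using nearest_point[OF assms] assms(1,2) by (auto intro!: any_closest_point_dot)
  then show ?thesis
    by (simp add: power2_norm_eq_inner inner_diff inner_commute algebra_simps)
qed

text \<open>Expanding the square leaves the excess
  \<open>4 * ((norm p)\<^sup>2 - inner (u - v) p)\<close>, nonpositive by firm nonexpansiveness of
  the projection.\<close>

lemma reflector_nonexpansive:
  fixes A :: "'a::{real_inner, complete_space} set"
  assumes "closed A" "convex A" "A \<noteq> {}"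
  shows "norm (reflector A u - reflector A v) \<le> norm (u - v)"
proof (rule power2_le_imp_le)
  define p where "p = nearest_point A u - nearest_point A v"
  have "reflector A u - reflector A v = 2 *\<^sub>R p - (u - v)"
    by (simp add: reflector_def p_def algebra_simps)
  then have "(norm (reflector A u - reflector A v))\<^sup>2
      = (norm (u - v))\<^sup>2 + 4 * ((norm p)\<^sup>2 - inner (u - v) p)"
    by (simp only: power2_norm_eq_inner)
       (simp add: inner_diff_left inner_diff_right inner_commute algebra_simps)
  then show "(norm (reflector A u - reflector A v))\<^sup>2 \<le> (norm (u - v))\<^sup>2"
    using nearest_point_firmly_nonexpansive[OF assms, of u v] by (simp add: p_def)
qed simp

subsection \<open>Iterating a firmly nonexpansive operator\<close>

text \<open>The residual term is kept because it quantifies the decrease of the distance to a fixed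
  point \<open>v\<close>, where \<open>v - T v\<close> vanishes.\<close>

definition firmly_nonexpansive :: "('a::real_inner \<Rightarrow> 'a) \<Rightarrow> bool"
  where "firmly_nonexpansive T \<longleftrightarrow>
    (\<forall>u v. (norm (T u - T v))\<^sup>2 + (norm ((u - T u) - (v - T v)))\<^sup>2 \<le> (norm (u - v))\<^sup>2)"

text \<open>Parallelogram law: the squared norms of the halves of \<open>d + n\<close> and
  \<open>d - n\<close> add up to the mean of \<open>(norm d)\<^sup>2\<close> and
  \<open>(norm n)\<^sup>2\<close>.\<close>

lemma firmly_nonexpansive_average:
  fixes N :: "'a::real_inner \<Rightarrow> 'a"
  assumes "\<And>u v. norm (N u - N v) \<le> norm (u - v)"
  shows "firmly_nonexpansive (\<lambda>u. (1/2) *\<^sub>R (u + N u))"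
  unfolding firmly_nonexpansive_def
proof (intro allI)
  fix u v
  define d n where "d = u - v" and "n = N u - N v"
  have 1: "(1/2) *\<^sub>R (u + N u) - (1/2) *\<^sub>R (v + N v) = (1/2) *\<^sub>R (d + n)"
    by (simp add: d_def n_def algebra_simps)
  have 2: "(u - (1/2) *\<^sub>R (u + N u)) - (v - (1/2) *\<^sub>R (v + N v)) = (1/2) *\<^sub>R (d - n)"
    using scaleR_half_double[of u] scaleR_half_double[of v]
    by (simp add: d_def n_def algebra_simps flip: scaleR_add_left)
  have "(norm n)\<^sup>2 \<le> (norm d)\<^sup>2"
    unfolding d_def n_def using assms by (intro power_mono) auto
  then show "(norm ((1/2) *\<^sub>R (u + N u) - (1/2) *\<^sub>R (v + N v)))\<^sup>2
      + (norm ((u - (1/2) *\<^sub>R (u + N u)) - (v - (1/2) *\<^sub>R (v + N v))))\<^sup>2 \<le> (norm (u - v))\<^sup>2"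
    unfolding 1 2 d_def[symmetric]
    by (simp add: power2_norm_eq_inner inner_add inner_diff inner_commute algebra_simps)
qed

section \<open>The Douglas-Rachford operator and its fixed points\<close>

lemma DR_operator_firmly_nonexpansive:
  fixes C D :: "'a::{real_inner, complete_space} set"
  assumes "closed C" "convex C" "C \<noteq> {}" "closed D" "convex D" "D \<noteq> {}"
  shows "firmly_nonexpansive (DR_operator C D)"
proof -
  have "norm (reflector D (reflector C u) - reflector D (reflector C v)) \<le> norm (u - v)" for u v
    by (rule order_trans[OF reflector_nonexpansive reflector_nonexpansive]) (use assms in auto)
  from firmly_nonexpansive_average[of "\<lambda>u. reflector D (reflector C u)", OF this]
  show ?thesis
    by (simp add: DR_operator_def[abs_def])
qed

text \<open>The right-hand side is one step of the algorithm, so the iterates form an orbit of the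
  operator.\<close>

lemma DR_operator_eq:
  "DR_operator C D u = u + (nearest_point D (2 *\<^sub>R nearest_point C u - u) - nearest_point C u)"
proof -
  have "u + reflector D (reflector C u)
      = 2 *\<^sub>R (u + (nearest_point D (2 *\<^sub>R nearest_point C u - u) - nearest_point C u))"
    by (simp add: reflector_def scaleR_2 algebra_simps)
  then show ?thesis
    by (simp add: DR_operator_def)
qed

lemma DR_operator_fixed_point:
  fixes C D :: "'a::{real_inner, complete_space} set"
  assumes "closed C" "convex C" "closed D" "convex D" "u \<in> C \<inter> D"
  shows "u \<in> Fix (DR_operator C D)"
proof -
  have "nearest_point C u = u" "nearest_point D u = u"
    using assms by (auto intro: nearest_point_self)
  then show ?thesis
    by (simp add: Fix_def DR_operator_eq scaleR_2)
qed

section \<open>Distances to the fixed point set and Fejer monotone sequences\<close>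

lemma firmly_nonexpansive_norm_le:
  assumes "firmly_nonexpansive T"
  shows "norm (T u - T v) \<le> norm (u - v)"
proof (rule power2_le_imp_le)
  have "(norm (T u - T v))\<^sup>2 + (norm ((u - T u) - (v - T v)))\<^sup>2 \<le> (norm (u - v))\<^sup>2"
    using assms by (simp add: firmly_nonexpansive_def)
  then show "(norm (T u - T v))\<^sup>2 \<le> (norm (u - v))\<^sup>2"
    using zero_le_power2[of "norm ((u - T u) - (v - T v))"] by linarith
qed simp

lemma firmly_nonexpansive_infdist_decrease:
  assumes "firmly_nonexpansive T" "Fix T \<noteq> {}"
  shows "(infdist (T u) (Fix T))\<^sup>2 + (norm (u - T u))\<^sup>2 \<le> (infdist u (Fix T))\<^sup>2"
    (is "?l \<le> _")
proof -
  \<comment> \<open>Taking the root first gives a lower bound on \<open>dist u f\<close> itself, the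
    form that passes to the infimum over \<open>f\<close>.\<close>
  have "sqrt ?l \<le> dist u f" if "f \<in> Fix T" for f
  proof (rule real_le_lsqrt)
    have "T f = f"
      using that by (simp add: Fix_def)
    then have "(dist (T u) f)\<^sup>2 + (norm (u - T u))\<^sup>2 \<le> (dist u f)\<^sup>2"
      using assms(1)[unfolded firmly_nonexpansive_def, rule_format, of u f]
      by (simp add: dist_norm)
    moreover have "(infdist (T u) (Fix T))\<^sup>2 \<le> (dist (T u) f)\<^sup>2"
      by (intro power_mono infdist_le infdist_nonneg that)
    ultimately show "?l \<le> (dist u f)\<^sup>2"
      by linarith
  qed auto
  then have "sqrt ?l \<le> infdist u (Fix T)"
    by (intro infdist_greatest assms(2))
  then show ?thesis
    by (rule sqrt_le_D)
qed

text \<open>Later terms are at least as close to each \<open>f\<close> as \<open>x t\<close> is, so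
  the triangle inequality through \<open>f\<close>, followed by the infimum over \<open>f\<close>,
  gives the factor 2.\<close>

lemma fejer_convergence:
  fixes x :: "nat \<Rightarrow> 'a::complete_space"
  assumes fejer: "\<And>t f. f \<in> F \<Longrightarrow> dist (x (Suc t)) f \<le> dist (x t) f"
    and "F \<noteq> {}" and lim: "(\<lambda>t. infdist (x t) F) \<longlonglongrightarrow> 0"
  obtains xbar where "x \<longlonglongrightarrow> xbar" "\<And>t. dist (x t) xbar \<le> 2 * infdist (x t) F"
proof -
  have tail: "dist (x t) (x s) \<le> 2 * infdist (x t) F" if "t \<le> s" for s t
  proof -
    have "dist (x t) (x s) / 2 \<le> dist (x t) f" if "f \<in> F" for f
    proof -
      have "dist (x s) f \<le> dist (x t) f"
        using \<open>t \<le> s\<close> by (induction rule: dec_induct) (use fejer[OF that] order_trans in blast)+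
      then show ?thesis
        using dist_triangle2[of "x t" "x s" f] by linarith
    qed
    then have "dist (x t) (x s) / 2 \<le> infdist (x t) F"
      by (intro infdist_greatest \<open>F \<noteq> {}\<close>)
    then show ?thesis
      by linarith
  qed
  have "Cauchy x"
  proof (rule CauchyI')
    fix e :: real
    assume "e > 0"
    then have "\<forall>\<^sub>F t in sequentially. infdist (x t) F < e / 2"
      using lim by (intro order_tendstoD) auto
    then obtain t0 where "\<And>t. t \<ge> t0 \<Longrightarrow> infdist (x t) F < e / 2"
      by (auto simp: eventually_sequentially)
    then have "dist (x m) (x n) < e" if "m \<ge> t0" "n > m" for m n
      using tail[of m n] that by (smt (verit) field_sum_of_halves less_imp_le)
    then show "\<exists>M. \<forall>m\<ge>M. \<forall>n>m. dist (x m) (x n) < e"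
      by blast
  qed
  then obtain xbar where xbar: "x \<longlonglongrightarrow> xbar"
    using Cauchy_convergent convergent_def by blast
  have "dist (x t) xbar \<le> 2 * infdist (x t) F" for t
  proof (rule LIMSEQ_le_const2)
    show "(\<lambda>s. dist (x t) (x s)) \<longlonglongrightarrow> dist (x t) xbar"
      by (intro tendsto_intros xbar)
  qed (use tail in blast)
  with xbar show ?thesis
    by (rule that)
qed

subsection \<open>Rates from the recursion\<close>

text \<open>Since \<open>(1 - w) powr (-p) \<ge> 1 + p * w\<close>, each step increases \<open>b t powr (-p)\<close> by at least \<open>p * c\<close>.\<close>

lemma power_recursion_rate:
  fixes b :: "nat \<Rightarrow> real"
  assumes "c > 0" "p > 0" and nonneg: "\<And>t. 0 \<le> b t"
    and rec: "\<And>t. b (Suc t) \<le> b t - c * b t powr (1 + p)" and "t \<ge> 1"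
  shows "b t \<le> (p * c * real t) powr (- (1 / p))"
proof (cases "b t = 0")
  case False
  \<comment> \<open>Restricted to positive \<open>b t\<close> because \<open>0 powr (- p)\<close> is
    0; for \<open>b t = 0\<close> the claim of the lemma is trivial.\<close>
  have growth: "p * c * real t \<le> b t powr (- p)" if "b t > 0" for t
    using that
  proof (induction t)
    case (Suc t)
    \<comment> \<open>If \<open>b t\<close> were 0, the recursion would force
      \<open>b (Suc t) \<le> 0\<close>. Positivity thus passes backwards to the induction
      hypothesis.\<close>
    have pos: "b t > 0"
      using Suc.prems rec[of t] nonneg[of t] \<open>c > 0\<close> by (cases "b t = 0") auto
    define w where "w = c * b t powr p"
    have "w > 0"
      using pos \<open>c > 0\<close> by (simp add: w_def)
    have step: "b (Suc t) \<le> b t * (1 - w)"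
      using rec[of t] pos by (simp add: w_def powr_add algebra_simps)
    then have "0 < b t * (1 - w)"
      using Suc.prems by linarith
    then have "w < 1"
      using pos by (simp add: zero_less_mult_iff)
    \<comment> \<open>Bernoulli's inequality for the exponent \<open>- p\<close>, from
      \<open>ln (1 - w) \<le> - w\<close> and \<open>1 + a \<le> exp a\<close>.\<close>
    have "1 + p * w \<le> 1 + (- p) * ln (1 - w)"
      using mult_left_mono[OF ln_le_minus_one[of "1 - w"], of p] \<open>w < 1\<close> \<open>p > 0\<close> by simp
    also have "\<dots> \<le> exp ((- p) * ln (1 - w))"
      by (rule exp_ge_add_one_self)
    also have "\<dots> = (1 - w) powr (- p)"
      using \<open>w < 1\<close> by (simp add: powr_def)
    finally have bernoulli: "1 + p * w \<le> (1 - w) powr (- p)" .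
    have "p * c * real (Suc t) \<le> b t powr (- p) + p * c"
      using Suc.IH[OF pos] by (simp add: algebra_simps)
    also have "\<dots> = b t powr (- p) * (1 + p * w)"
      using pos by (simp add: w_def powr_minus field_simps)
    also have "\<dots> \<le> b t powr (- p) * (1 - w) powr (- p)"
      using bernoulli by (intro mult_left_mono) auto
    also have "\<dots> = (b t * (1 - w)) powr (- p)"
      using pos \<open>w < 1\<close> by (simp add: powr_mult)
    also have "\<dots> \<le> b (Suc t) powr (- p)"
      using step Suc.prems \<open>p > 0\<close> by (intro powr_mono2') auto
    finally show ?case .
  qed simp
  have pos: "b t > 0"
    using False nonneg[of t] by simp
  have "b t = (b t powr (- p)) powr (- (1 / p))"
    using pos \<open>p > 0\<close> by (simp add: powr_powr)
  also have "\<dots> \<le> (p * c * real t) powr (- (1 / p))"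
    using growth[OF pos] assms by (intro powr_mono2') auto
  finally show ?thesis .
qed simp

text \<open>For \<open>\<gamma> < 1\<close> the squares of \<open>d\<close> satisfy the recursion of
  \<open>power_recursion_rate\<close>; for \<open>\<gamma> = 1\<close> each step contracts
  \<open>d\<close> by a fixed factor.\<close>

lemma holder_recursion_rate:
  fixes d s :: "nat \<Rightarrow> real"
  assumes \<gamma>: "\<gamma> \<in> {0<..1}" and "\<mu> > 0" and nonneg: "\<And>t. 0 \<le> d t" "\<And>t. 0 \<le> s t"
    and reg: "\<And>t. d t \<le> \<mu> * s t powr \<gamma>"
    and rec: "\<And>t. (d (Suc t))\<^sup>2 + (s t)\<^sup>2 \<le> (d t)\<^sup>2"
  shows "\<exists>M>0. \<exists>r\<in>{0<..<1}. \<forall>t\<ge>1. d t \<le>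
    (if \<gamma> < 1 then M * real t powr (- (\<gamma> / (2 * (1 - \<gamma>)))) else M * r ^ t)"
proof (cases "\<gamma> < 1")
  case True
  \<comment> \<open>Raising the regularity bound to the power \<open>2 / \<gamma>\<close> gives
    \<open>d t powr (2 / \<gamma>) \<le> \<mu> powr (2 / \<gamma>) * (s t)\<^sup>2\<close>. This
    dictates \<open>c\<close>, and \<open>2 * (1 + p) = 2 / \<gamma>\<close> dictates
    \<open>p\<close>.\<close>
  define p c where "p = 1 / \<gamma> - 1" and "c = \<mu> powr (- (2 / \<gamma>))"
  have "p > 0" "c > 0"
    using True \<gamma> \<open>\<mu> > 0\<close> by (auto simp: p_def c_def)
  have "c * (d t)\<^sup>2 powr (1 + p) \<le> (s t)\<^sup>2" for t
  proof -
    have "(d t)\<^sup>2 powr (1 + p) = (d t powr 2) powr (1 + p)"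
      using nonneg(1)[of t] by simp
    also have "\<dots> = d t powr (2 / \<gamma>)"
      by (simp only: powr_powr) (simp add: p_def)
    also have "\<dots> \<le> (\<mu> * s t powr \<gamma>) powr (2 / \<gamma>)"
      using reg[of t] nonneg(1)[of t] \<gamma> by (intro powr_mono2) auto
    also have "\<dots> = \<mu> powr (2 / \<gamma>) * (s t)\<^sup>2"
      using \<gamma> \<open>\<mu> > 0\<close> nonneg(2)[of t] by (simp add: powr_mult powr_powr)
    finally show ?thesis
      using \<open>\<mu> > 0\<close> by (simp add: c_def powr_minus field_simps)
  qed
  then have rec': "(d (Suc t))\<^sup>2 \<le> (d t)\<^sup>2 - c * (d t)\<^sup>2 powr (1 + p)" for t
    using rec[of t] by (smt (verit))
  have expo: "1 / p / 2 = \<gamma> / (2 * (1 - \<gamma>))"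
    using True \<gamma> by (simp add: p_def field_simps)
  \<comment> \<open>The rate for the squares has exponent \<open>1 / p\<close>; the square root
    halves it.\<close>
  define M where "M = (p * c) powr (- (1 / p / 2))"
  have "d t \<le> M * real t powr (- (1 / p / 2))" if "t \<ge> 1" for t
  proof (rule power2_le_imp_le)
    have "(d t)\<^sup>2 \<le> (p * c * real t) powr (- (1 / p))"
      using power_recursion_rate[of c p "\<lambda>t. (d t)\<^sup>2" t] \<open>c > 0\<close> \<open>p > 0\<close> rec' that by simp
    also have "\<dots> = ((p * c * real t) powr (- (1 / p / 2)))\<^sup>2"
      by (simp add: power2_eq_square flip: powr_add)
    also have "(p * c * real t) powr (- (1 / p / 2)) = M * real t powr (- (1 / p / 2))"
      using \<open>p > 0\<close> \<open>c > 0\<close> by (simp add: M_def powr_mult)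
    finally show "(d t)\<^sup>2 \<le> (M * real t powr (- (1 / p / 2)))\<^sup>2" .
  qed (simp add: M_def)
  moreover have "M > 0"
    using \<open>p > 0\<close> \<open>c > 0\<close> by (simp add: M_def)
  \<comment> \<open>The bound of this branch does not contain \<open>r\<close>; \<open>1/2\<close>
    is an arbitrary element of the interval.\<close>
  ultimately show ?thesis
    using True unfolding expo by (intro exI[of _ M] conjI bexI[of _ "1/2"]) auto
next
  case False
  then have "\<gamma> = 1"
    using \<gamma> by simp
  \<comment> \<open>\<open>\<mu>\<close> is enlarged to \<open>\<mu> + 1\<close> so that the contraction factor is positive.\<close>
  define r where "r = sqrt (1 - 1 / (\<mu> + 1)\<^sup>2)"
  have "(\<mu> + 1)\<^sup>2 > 1"
    using \<open>\<mu> > 0\<close> by (simp add: one_less_power)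
  then have r: "0 < r" "r < 1" "r\<^sup>2 = 1 - 1 / (\<mu> + 1)\<^sup>2"
    by (auto simp: r_def divide_less_eq divide_le_eq)
  have step: "d (Suc t) \<le> r * d t" for t
  proof (rule power2_le_imp_le)
    have "d t \<le> (\<mu> + 1) * s t"
      using reg[of t] nonneg(2)[of t] \<open>\<gamma> = 1\<close> by (auto simp: algebra_simps)
    then have "(d t)\<^sup>2 \<le> ((\<mu> + 1) * s t)\<^sup>2"
      using nonneg(1) by (intro power_mono)
    then have "(d t)\<^sup>2 / (\<mu> + 1)\<^sup>2 \<le> (s t)\<^sup>2"
      using \<open>\<mu> > 0\<close> by (simp add: power_mult_distrib divide_le_eq mult.commute)
    then show "(d (Suc t))\<^sup>2 \<le> (r * d t)\<^sup>2"
      using rec[of t] by (simp add: power_mult_distrib r(3) algebra_simps)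
  qed (use nonneg r in auto)
  have "d t \<le> d 0 * r ^ t" for t
  proof (induction t)
    case (Suc t)
    then have "r * d t \<le> r * (d 0 * r ^ t)"
      using r by (intro mult_left_mono) auto
    then show ?case
      using step[of t] by (simp add: algebra_simps)
  qed simp
  \<comment> \<open>Since \<open>d 0\<close> may vanish, 1 is added to make the constant
    positive.\<close>
  moreover have "d 0 * r ^ t \<le> (d 0 + 1) * r ^ t" for t
    using r by (intro mult_right_mono) auto
  ultimately have "d t \<le> (d 0 + 1) * r ^ t" for t
    using order_trans by blast
  then show ?thesis
    using False r nonneg(1)[of 0] by (intro exI[of _ "d 0 + 1"] conjI bexI[of _ r]) auto
qed

text \<open>The sequence \<open>real t * r ^ t\<close> tends to 0, hence is bounded. This turns the
  linear rate for \<open>\<gamma> = 1\<close> into a sublinear one with exponent 1.\<close>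

lemma geometric_le_inverse:
  fixes r :: real
  assumes "0 < r" "r < 1"
  obtains B where "B > 0" "\<And>t. t \<ge> 1 \<Longrightarrow> r ^ t \<le> B * real t powr (- 1)"
proof -
  have "(\<lambda>t. real t * r ^ t) \<longlonglongrightarrow> 0"
    using assms by (intro powser_times_n_limit_0) auto
  then have "Bseq (\<lambda>t. real t * r ^ t)"
    by (intro convergent_imp_Bseq) (auto simp: convergent_def)
  then obtain B where "B > 0" "\<And>t. norm (real t * r ^ t) \<le> B"
    by (auto elim: BseqE)
  then have "r ^ t \<le> B * real t powr (- 1)" if "t \<ge> 1" for t
    using that assms by (simp add: powr_minus field_simps abs_mult)
  with \<open>B > 0\<close> show ?thesis
    by (rule that)
qed

section \<open>Convergence and rates of the Douglas-Rachford iterates\<close>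

theorem corollary4p4:
  fixes C D :: "'a::{real_inner, complete_space} set"
    and x y z :: "nat \<Rightarrow> 'a"
  assumes "closed C" "convex C" "closed D" "convex D" "C \<inter> D \<noteq> {}"
    and "\<And>t. y (Suc t) = nearest_point C (x t)"
    and "\<And>t. z (Suc t) = nearest_point D (2 *\<^sub>R y (Suc t) - x t)"
    and "\<And>t. x (Suc t) = x t + (z (Suc t) - y (Suc t))"
    and "bounded_holder_regular (DR_operator C D)"
  shows "\<exists>xbar \<in> Fix (DR_operator C D).
    x \<longlonglongrightarrow> xbar \<and>
    (\<exists>\<rho>>0. \<exists>M. \<forall>t\<ge>1. norm (x t - xbar) \<le> M * real t powr (- \<rho>)) \<and>
    (\<forall>\<gamma>. bounded_holder_regular_uniform \<gamma> (DR_operator C D) \<longrightarrow>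
      (\<exists>M>0. \<exists>r\<in>{0<..<1}. \<forall>t\<ge>1.
        norm (x t - xbar) \<le>
          (if \<gamma> < 1 then M * real t powr (- (\<gamma> / (2 * (1 - \<gamma>)))) else M * r ^ t)))"
proof -
  let ?T = "DR_operator C D"
  let ?F = "Fix ?T"
  have firm: "firmly_nonexpansive ?T"
    using assms(1-5) by (intro DR_operator_firmly_nonexpansive) auto
  have "?F \<noteq> {}"
    using DR_operator_fixed_point[OF assms(1-4)] assms(5) by blast
  have iter: "x (Suc t) = ?T (x t)" for t
    by (simp add: assms(6-8) DR_operator_eq)
  have fejer: "dist (x (Suc t)) f \<le> dist (x t) f" if "f \<in> ?F" for t f
    using firmly_nonexpansive_norm_le[OF firm, of "x t" f] that
    by (simp add: iter Fix_def dist_norm)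
  obtain f where "f \<in> ?F"
    using \<open>?F \<noteq> {}\<close> by blast
  \<comment> \<open>Fejer monotonicity towards one fixed point bounds the orbit, so regularity can
    be applied with \<open>K = range x\<close>.\<close>
  have "dist f (x t) \<le> dist f (x 0)" for t
    by (induction t) (use fejer[OF \<open>f \<in> ?F\<close>] order_trans in \<open>auto simp: dist_commute\<close>)
  then have bdd: "bounded (range x)"
    by (auto simp: bounded_def)

  define d where "d t = infdist (x t) ?F" for t
  \<comment> \<open>Stated for regularity on the orbit alone, so that it serves both the exponent
    belonging to \<open>range x\<close> and a uniform exponent.\<close>
  have rate: "\<exists>M>0. \<exists>r\<in>{0<..<1}. \<forall>t\<ge>1. d t \<le>
      (if \<gamma> < 1 then M * real t powr (- (\<gamma> / (2 * (1 - \<gamma>)))) else M * r ^ t)"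
    if \<gamma>: "\<gamma> \<in> {0<..1}" "holder_regular_on (range x) \<gamma> ?T" for \<gamma>
  proof -
    obtain \<mu> where "\<mu> > 0" "\<And>t. d t \<le> \<mu> * norm (x t - ?T (x t)) powr \<gamma>"
      using \<gamma>(2) by (auto simp: holder_regular_on_def d_def)
    then show ?thesis
      using \<gamma>(1) firmly_nonexpansive_infdist_decrease[OF firm \<open>?F \<noteq> {}\<close>]
      by (intro holder_recursion_rate[of \<gamma> \<mu> d "\<lambda>t. norm (x t - ?T (x t))"])
         (auto simp: d_def infdist_nonneg iter)
  qed

  obtain \<rho> M where "\<rho> > 0" and sublinear: "\<And>t. t \<ge> 1 \<Longrightarrow> d t \<le> M * real t powr (- \<rho>)"
  proof -
    obtain \<gamma> where \<gamma>: "\<gamma> \<in> {0<..1}" "holder_regular_on (range x) \<gamma> ?T"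
      using assms(9) bdd by (auto simp: bounded_holder_regular_def)
    obtain M r where M: "M > 0" "0 < r" "r < 1" and
      le: "\<And>t. t \<ge> 1 \<Longrightarrow> d t \<le>
        (if \<gamma> < 1 then M * real t powr (- (\<gamma> / (2 * (1 - \<gamma>)))) else M * r ^ t)"
      using rate[OF \<gamma>] by auto
    show ?thesis
    proof (cases "\<gamma> < 1")
      case True
      then show ?thesis
        using \<gamma> le by (intro that[of "\<gamma> / (2 * (1 - \<gamma>))" M]) auto
    next
      case False
      obtain B where B: "\<And>t. t \<ge> 1 \<Longrightarrow> r ^ t \<le> B * real t powr (- 1)"
        using geometric_le_inverse[OF M(2,3)] by blast
      have "d t \<le> (M * B) * real t powr (- 1)" if "t \<ge> 1" for t
        using le[OF that] mult_left_mono[OF B[OF that], of M] M(1) False by (simp add: mult.assoc)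
      then show ?thesis
        by (intro that[of 1 "M * B"]) auto
    qed
  qed
  have "((\<lambda>t. M * real t powr (- \<rho>)) \<longlongrightarrow> M * 0) sequentially"
    using \<open>\<rho> > 0\<close>
    by (intro tendsto_mult tendsto_const tendsto_neg_powr filterlim_real_sequentially) auto
  then have "d \<longlonglongrightarrow> 0"
    using sublinear
    by (intro tendsto_sandwich[of "\<lambda>_. 0" d _ "\<lambda>t. M * real t powr (- \<rho>)"])
       (auto simp: d_def infdist_nonneg eventually_sequentially)
  then obtain xbar where lim: "x \<longlonglongrightarrow> xbar" and le: "\<And>t. norm (x t - xbar) \<le> 2 * d t"
    using fejer_convergence[of ?F x] fejer \<open>?F \<noteq> {}\<close> unfolding d_def dist_norm by blast

  \<comment> \<open>By nonexpansiveness the shifted iterates tend to \<open>?T xbar\<close>; they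
    also tend to \<open>xbar\<close>, so uniqueness of limits makes \<open>xbar\<close> a fixed
    point.\<close>
  have "(\<lambda>t. x (Suc t) - ?T xbar) \<longlonglongrightarrow> 0"
  proof (rule Lim_null_comparison)
    show "(\<lambda>t. norm (x t - xbar)) \<longlonglongrightarrow> 0"
      using lim by (simp add: tendsto_norm_zero LIM_zero)
    show "\<forall>\<^sub>F t in sequentially. norm (x (Suc t) - ?T xbar) \<le> norm (x t - xbar)"
      unfolding iter by (simp add: firmly_nonexpansive_norm_le[OF firm])
  qed
  then have "(\<lambda>t. x (Suc t)) \<longlonglongrightarrow> ?T xbar"
    by (rule LIM_zero_cancel)
  then have "?T xbar = xbar"
    using LIMSEQ_Suc[OF lim] by (rule LIMSEQ_unique)
  then have "xbar \<in> ?F"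
    by (simp add: Fix_def)
  moreover have "\<forall>t\<ge>1. norm (x t - xbar) \<le> (2 * M) * real t powr (- \<rho>)"
  proof (intro allI impI)
    fix t :: nat
    assume "t \<ge> 1"
    then show "norm (x t - xbar) \<le> (2 * M) * real t powr (- \<rho>)"
      using le[of t] sublinear[of t] by linarith
  qed
  \<comment> \<open>Here \<open>xbar\<close> is chosen before \<open>\<gamma>\<close>, so one limit
    serves every exponent. The Fejer bound doubles the constant \<open>M\<close>.\<close>
  moreover have "\<exists>M>0. \<exists>r\<in>{0<..<1}. \<forall>t\<ge>1. norm (x t - xbar) \<le>
      (if \<gamma> < 1 then M * real t powr (- (\<gamma> / (2 * (1 - \<gamma>)))) else M * r ^ t)"
    if "bounded_holder_regular_uniform \<gamma> ?T" for \<gamma>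
  proof -
    have "\<gamma> \<in> {0<..1}" "holder_regular_on (range x) \<gamma> ?T"
      using that bdd by (auto simp: bounded_holder_regular_uniform_def)
    from rate[OF this] obtain M r where "M > 0" "r \<in> {0<..<1}" and
      M: "\<And>t. t \<ge> 1 \<Longrightarrow> d t \<le>
        (if \<gamma> < 1 then M * real t powr (- (\<gamma> / (2 * (1 - \<gamma>)))) else M * r ^ t)"
      by blast
    have "norm (x t - xbar) \<le>
        (if \<gamma> < 1 then (2 * M) * real t powr (- (\<gamma> / (2 * (1 - \<gamma>)))) else (2 * M) * r ^ t)"
      if "t \<ge> 1" for t
      using le[of t] M[OF that] by (auto split: if_splits)
    then show ?thesis
      using \<open>M > 0\<close> \<open>r \<in> {0<..<1}\<close> by (intro exI[of _ "2 * M"] conjI bexI[of _ r]) auto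
  qed
  ultimately show ?thesis
    using lim \<open>\<rho> > 0\<close> by blast
qed

end
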